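(* Let $d,m\geqslant 1$, let $f_1,\ldots,f_m:\mathbb{R}^d\to\mathbb{R}^d$ be globally Lipschitz continuous, and let $f(y,u)=\sum_{j=1}^m u_jf_j(y)$ (no drift term). Let $\overline{y}\in\mathbb{R}^d$ and $y^0\in\mathbb{R}^d$. Assume that the system $\dot y=f(y,u)$ is controllable in some time $T_0>0$ with local cost estimate around $\overline{y}$ (Assumption (A) in the context). Then there exist a time $T^*>0$ and constants $C>0$ and $\mu>0$, all depending on $T_0,y^0,\overline{y}$ (and not on $T$), such that for every $T>T^*$, every global minimizer $u_T\in L^2(0,T;\mathbb{R}^m)$ of $$J_T(u)=\int_0^T\|y(t)-\overline{y}\|^2\,\mathrm{d}t+\int_0^T\|u(t)\|^2\,\mathrm{d}t$$ (where $y$ solves $\dot y=f(y,u)$ in $(0,T)$, $y(0)=y^0$; there is no final cost) and the corresponding state $y_T$, solution to $\dot y_T=f(y_T,u_T)$ with $y_T(0)=y^0$, satisfy $$\|y_T(t)-\overline{y}\|\leqslant Ce^{-\mu t}\ \text{ for all }t\in[0,T]\quad\text{and}\quad\|u_T(t)\|\leqslant Ce^{-\mu t}\ \text{ for a.e. }t\in[0,T].$$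
   Context: $\|\cdot\|$ is the Euclidean norm. For every $y^0\in\mathbb{R}^d$ and $u\in L^1(0,T;\mathbb{R}^m)$, the system $\dot y=f(y,u)$ on $(0,T)$ with $y(0)=y^0$ has a unique solution $y\in C^0([0,T];\mathbb{R}^d)$, understood through the integral formulation $y(t)=y^0+\int_0^tf(y(s),u(s))\,\mathrm{d}s$. Assumption (A) (controllability and cost estimate), for a time $T_0>0$ and the point $\overline{y}$: (i) for any $y^0,y^1\in\mathbb{R}^d$ there exists $u\in L^2(0,T_0;\mathbb{R}^m)$ such that the solution $y$ of $\dot y=f(y,u)$ on $(0,T_0)$ with $y(0)=y^0$ satisfies $y(T_0)=y^1$; (ii) there exist a radius $r>0$ and a constant $C(T_0)>0$ such that for all $y^0,y^1\in\{x\in\mathbb{R}^d:\|x-\overline{y}\|\leqslant r\}$, $$\inf\left\{\|u\|_{L^2(0,T_0;\mathbb{R}^m)}: y(0)=y^0,\ y(T_0)=\overline{y}\right\}\leqslant C(T_0)\|y^0-\overline{y}\|,$$ $$\inf\left\{\|u\|_{L^2(0,T_0;\mathbb{R}^m)}: y(0)=\overline{y},\ y(T_0)=y^1\right\}\leqslant C(T_0)\|y^1-\overline{y}\|,$$ where in each infimum $u$ ranges over controls in $L^2(0,T_0;\mathbb{R}^m)$ whose associated solution $y$ of $\dot y=f(y,u)$ has the indicated endpoint values. *)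

theory Defs
  imports "HOL-Analysis.Analysis"
begin

definition driftless :: "('m::finite \<Rightarrow> real^'d::finite \<Rightarrow> real^'d) \<Rightarrow> real^'d \<Rightarrow> real^'m \<Rightarrow> real^'d"
  where "driftless fs y u = (\<Sum>j\<in>UNIV. (u $ j) *\<^sub>R fs j y)"

text \<open>Elements of $L^2(0,T;\mathbb{R}^m)$ are represented by functions; values outside $[0,T]$
  and on null sets are irrelevant below.\<close>

definition L2 :: "real \<Rightarrow> (real \<Rightarrow> real^'m::finite) set"
  where "L2 T = {u. u \<in> borel_measurable (lebesgue_on {0..T}) \<and>
                    integrable (lebesgue_on {0..T}) (\<lambda>t. (norm (u t))\<^sup>2)}"

definition L2_norm :: "real \<Rightarrow> (real \<Rightarrow> real^'m::finite) \<Rightarrow> real"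
  where "L2_norm T u = sqrt (\<integral>t. (norm (u t))\<^sup>2 \<partial>(lebesgue_on {0..T}))"

text \<open>For a Lipschitz driftless system and a control in $L^1$ the integrability clause
  is implied by the continuity of the state.\<close>

definition is_solution ::
  "(real^'d::finite \<Rightarrow> real^'m::finite \<Rightarrow> real^'d) \<Rightarrow> real \<Rightarrow> real^'d \<Rightarrow> (real \<Rightarrow> real^'m) \<Rightarrow> (real \<Rightarrow> real^'d) \<Rightarrow> bool"
  where "is_solution f T y0 u y \<longleftrightarrow>
    continuous_on {0..T} y \<and>
    integrable (lebesgue_on {0..T}) (\<lambda>s. f (y s) (u s)) \<and>
    (\<forall>t\<in>{0..T}. y t = y0 + (\<integral>s. f (y s) (u s) \<partial>(lebesgue_on {0..t})))"

text \<open>The solution is unique only as a function on $[0,T]$, hence a choice operator rather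
  than a definite description; only the values on $[0,T]$ are used.\<close>

definition state ::
  "(real^'d::finite \<Rightarrow> real^'m::finite \<Rightarrow> real^'d) \<Rightarrow> real \<Rightarrow> real^'d \<Rightarrow> (real \<Rightarrow> real^'m) \<Rightarrow> real \<Rightarrow> real^'d"
  where "state f T y0 u = (SOME y. is_solution f T y0 u y)"

definition steers ::
  "(real^'d::finite \<Rightarrow> real^'m::finite \<Rightarrow> real^'d) \<Rightarrow> real \<Rightarrow> real^'d \<Rightarrow> real^'d \<Rightarrow> (real \<Rightarrow> real^'m) \<Rightarrow> bool"
  where "steers f T a b u \<longleftrightarrow> u \<in> L2 T \<and> (\<exists>y. is_solution f T a u y \<and> y T = b)"

text \<open>The sets of norms below are bounded below by $0$, and nonempty by the first conjunct,
  so the real-valued infimum is the genuine one.\<close>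

definition controllable_with_local_cost ::
  "(real^'d::finite \<Rightarrow> real^'m::finite \<Rightarrow> real^'d) \<Rightarrow> real \<Rightarrow> real^'d \<Rightarrow> bool"
  where "controllable_with_local_cost f T0 ybar \<longleftrightarrow>
    (\<forall>y0 y1. \<exists>u. steers f T0 y0 y1 u) \<and>
    (\<exists>r>0. \<exists>K>0. \<forall>y0\<in>cball ybar r. \<forall>y1\<in>cball ybar r.
       (INF u\<in>{u. steers f T0 y0 ybar u}. L2_norm T0 u) \<le> K * norm (y0 - ybar) \<and>
       (INF u\<in>{u. steers f T0 ybar y1 u}. L2_norm T0 u) \<le> K * norm (y1 - ybar))"

definition cost ::
  "(real^'d::finite \<Rightarrow> real^'m::finite \<Rightarrow> real^'d) \<Rightarrow> real^'d \<Rightarrow> real^'d \<Rightarrow> real \<Rightarrow> (real \<Rightarrow> real^'m) \<Rightarrow> real"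
  where "cost f y0 ybar T u =
    (\<integral>t. (norm (state f T y0 u t - ybar))\<^sup>2 \<partial>(lebesgue_on {0..T})) +
    (\<integral>t. (norm (u t))\<^sup>2 \<partial>(lebesgue_on {0..T}))"

definition global_minimizer ::
  "(real^'d::finite \<Rightarrow> real^'m::finite \<Rightarrow> real^'d) \<Rightarrow> real^'d \<Rightarrow> real^'d \<Rightarrow> real \<Rightarrow> (real \<Rightarrow> real^'m) \<Rightarrow> bool"
  where "global_minimizer f y0 ybar T u \<longleftrightarrow>
    u \<in> L2 T \<and> (\<forall>v\<in>L2 T. cost f y0 ybar T u \<le> cost f y0 ybar T v)"

end

theory Submission
  imports Defs
begin

text \<open>Write \<open>x(t) = \<parallel>y(t) - ybar\<parallel>\<close> for an optimal pair. Without drift the state can be parked anywhere by the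
  zero control, so the remaining cost on \<open>[t, T]\<close> is at most \<open>K x(t)\<^sup>2\<close>: if \<open>T - t \<le> T0\<close>, stay at \<open>y(t)\<close>;
  if \<open>x(t)\<close> is small, steer to \<open>ybar\<close> at quadratic cost and stay there; if \<open>x(t)\<close> is not small, compare with
  the bound on the full cost, which does not depend on \<open>T\<close>. Hence \<open>E(t) = \<integral>\<^sub>t\<^sup>T x\<^sup>2\<close> satisfies
  \<open>E' = - x\<^sup>2 \<le> - E / K\<close> and decays exponentially; comparing \<open>y(t)\<close> with the point of smallest
  deviation on \<open>[t - 1, t]\<close> gives the decay of \<open>x\<close>. Replaying the piece of the trajectory over
  \<open>[a, a + h]\<close> at half speed and discarding the last piece of length \<open>h\<close>, which costs nothing in the absence
  of a final cost, cannot lower the cost; this gives \<open>\<integral> \<parallel>u\<parallel>\<^sup>2 \<le> 2 \<integral> x\<^sup>2\<close> on \<open>[a, a + h]\<close>, and by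
  Lebesgue differentiation \<open>\<parallel>u\<parallel>\<^sup>2 \<le> 2 x\<^sup>2\<close> almost everywhere.\<close>

section \<open>Integrals on intervals\<close>

text \<open>The quadratic form in \<open>p\<close>, \<open>q\<close> below is the integral of the
  square of \<open>f p - g q\<close>, so it is nonnegative; suitable choices of \<open>p\<close> and
  \<open>q\<close> give the discriminant inequality.\<close>

lemma integral_Cauchy_Schwarz:
  fixes f g :: "real \<Rightarrow> real"
  assumes f2: "(\<lambda>t. (f t)\<^sup>2) integrable_on S" and g2: "(\<lambda>t. (g t)\<^sup>2) integrable_on S"
    and fg: "(\<lambda>t. f t * g t) integrable_on S"
  shows "integral S (\<lambda>t. f t * g t) \<le> sqrt (integral S (\<lambda>t. (f t)\<^sup>2)) * sqrt (integral S (\<lambda>t. (g t)\<^sup>2))"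
proof -
  define A B C where "A = integral S (\<lambda>t. (f t)\<^sup>2)" and "B = integral S (\<lambda>t. f t * g t)"
    and "C = integral S (\<lambda>t. (g t)\<^sup>2)"
  have nonneg: "0 \<le> A * p\<^sup>2 - 2 * B * p * q + C * q\<^sup>2" for p q
  proof -
    have "((\<lambda>t. (f t)\<^sup>2 * p\<^sup>2 - f t * g t * (2 * p * q) + (g t)\<^sup>2 * q\<^sup>2) has_integral
        A * p\<^sup>2 - B * (2 * p * q) + C * q\<^sup>2) S"
      unfolding A_def B_def C_def
      by (intro has_integral_add has_integral_diff has_integral_mult_left integrable_integral assms)
    moreover have "0 \<le> (f t)\<^sup>2 * p\<^sup>2 - f t * g t * (2 * p * q) + (g t)\<^sup>2 * q\<^sup>2" for t
      using zero_le_power2[of "f t * p - g t * q"] by (simp add: power2_eq_square algebra_simps)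
    ultimately have "0 \<le> A * p\<^sup>2 - B * (2 * p * q) + C * q\<^sup>2"
      by (rule has_integral_nonneg)
    then show ?thesis by (simp add: algebra_simps)
  qed
  have C: "0 \<le> C" using nonneg[of 0 1] by simp
  have A: "0 \<le> A" using nonneg[of 1 0] by simp
  have "B\<^sup>2 \<le> A * C"
  proof (cases "C = 0")
    case True
    \<comment> \<open>The shift in \<open>q = A + 1\<close> keeps the factor \<open>A + 2\<close>
      positive, so that \<open>B = 0\<close> follows even when \<open>A = 0\<close>.\<close>
    have "0 \<le> - ((A + 2) * B\<^sup>2)"
      using nonneg[of B "A + 1"] True by (simp add: power2_eq_square algebra_simps)
    then have "B = 0" using A by (simp add: mult_le_0_iff)
    then show ?thesis using A C by simp
  next
    case False
    have "0 \<le> C * (A * C - B\<^sup>2)"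
      using nonneg[of C B] by (simp add: power2_eq_square algebra_simps)
    then show ?thesis using False C by (simp add: zero_le_mult_iff)
  qed
  then have "B \<le> sqrt (A * C)" by (rule real_le_rsqrt)
  then show ?thesis by (simp add: A_def B_def C_def real_sqrt_mult)
qed

text \<open>Lebesgue differentiation: almost every value of \<open>g\<close> is the limit of
  averages over intervals \<open>[t, t + h]\<close>. The room \<open>2 * h\<close> to the right is
  what the half-speed comparison in \<open>optimal_energy_le\<close> requires; for fixed
  \<open>t < T\<close> every small \<open>h\<close> has it.\<close>

lemma AE_nonpos_if_interval_integrals_nonpos:
  fixes g :: "real \<Rightarrow> real"
  assumes int: "g integrable_on {0..T}"
    and le: "\<And>a h. 0 \<le> a \<Longrightarrow> 0 < h \<Longrightarrow> a + 2 * h \<le> T \<Longrightarrow> integral {a..a+h} g \<le> 0"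
  shows "AE t in lebesgue_on {0..T}. g t \<le> 0"
proof -
  \<comment> \<open>Extension by zero, because the differentiation theorem asks for integrability on
    every box.\<close>
  define G where "G t = (if t \<in> {0..T} then g t else 0)" for t
  have "G integrable_on UNIV"
    unfolding G_def by (rule integrable_restrict_UNIV[THEN iffD2]) (rule int)
  then have "G integrable_on cbox a b" for a b
    by (rule integrable_on_subcbox) simp
  then obtain N where N: "negligible N"
    and lim: "\<And>x e. x \<notin> N \<Longrightarrow> 0 < e \<Longrightarrow> \<exists>d>0. \<forall>h. 0 < h \<and> h < d \<longrightarrow>
      norm (integral (cbox x (x + h *\<^sub>R One)) G /\<^sub>R h ^ DIM(real) - G x) < e"
    by (rule integrable_ccontinuous_explicit) blast
  have pt: "g t \<le> 0" if t: "0 \<le> t" "t < T" "t \<notin> N" for t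
  proof (rule ccontr)
    assume "\<not> g t \<le> 0"
    then have pos: "0 < g t" by simp
    obtain d where d: "d > 0" and *: "\<And>h. 0 < h \<Longrightarrow> h < d \<Longrightarrow>
        norm (integral {t..t+h} G /\<^sub>R h - G t) < g t"
      using lim[OF t(3) pos] by auto
    define h where "h = min (d/2) ((T - t)/2)"
    have h: "0 < h" "h < d" "t + 2 * h \<le> T" using d t by (auto simp: h_def min_def field_simps)
    have "integral {t..t+h} G = integral {t..t+h} g"
      using t h by (intro integral_cong) (auto simp: G_def)
    also have "\<dots> \<le> 0" using le t h by blast
    finally have "integral {t..t+h} G /\<^sub>R h \<le> 0" using h by (simp add: mult_nonneg_nonpos)
    with *[OF h(1,2)] t pos show False by (simp add: G_def)
  qed
  \<comment> \<open>The endpoint \<open>T\<close> joins the exceptional set, as no interval inside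
    \<open>[0, T]\<close> starts there.\<close>
  have "N \<union> {T} \<in> null_sets lebesgue"
    using N by (subst negligible_iff_null_sets[symmetric]) simp
  then have "AE t in lebesgue. t \<notin> N \<union> {T}" by (rule AE_not_in)
  then have "AE t in lebesgue. t \<in> {0..T} \<longrightarrow> g t \<le> 0"
    by eventually_elim (use pt in \<open>auto simp: less_le\<close>)
  then show ?thesis by (simp add: AE_restrict_space_iff)
qed

section \<open>Trajectories\<close>

text \<open>Gauge integrals over an arbitrary interval, with the initial value read off as
  \<open>y a\<close>: in this form pieces can be cut out, shifted, slowed down and glued.\<close>

definition trajectory :: "('s::euclidean_space \<Rightarrow> 'c::euclidean_space \<Rightarrow> 's) \<Rightarrow>
    real \<Rightarrow> real \<Rightarrow> (real \<Rightarrow> 'c) \<Rightarrow> (real \<Rightarrow> 's) \<Rightarrow> bool"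
  where "trajectory F a b u y \<longleftrightarrow> a \<le> b \<and> continuous_on {a..b} y \<and> u integrable_on {a..b} \<and>
    (\<lambda>t. (norm (u t))\<^sup>2) integrable_on {a..b} \<and>
    (\<forall>t\<in>{a..b}. ((\<lambda>s. F (y s) (u s)) has_integral (y t - y a)) {a..t})"

lemma trajectoryD:
  assumes "trajectory F a b u y"
  shows "a \<le> b" "continuous_on {a..b} y" "u integrable_on {a..b}"
    "(\<lambda>t. (norm (u t))\<^sup>2) integrable_on {a..b}"
    "\<And>t. t \<in> {a..b} \<Longrightarrow> ((\<lambda>s. F (y s) (u s)) has_integral (y t - y a)) {a..t}"
  using assms by (auto simp: trajectory_def)

lemma trajectory_dist_integrable:
  assumes "trajectory F a b u y"
  shows "(\<lambda>t. (norm (y t - c))\<^sup>2) integrable_on {a..b}"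
  by (intro integrable_continuous_real continuous_intros trajectoryD(2)[OF assms])

lemma trajectory_increment:
  assumes trajectory: "trajectory F a b u y" and st: "a \<le> s" "s \<le> t" "t \<le> b"
  shows "((\<lambda>r. F (y r) (u r)) has_integral (y t - y s)) {s..t}"
proof -
  note D = trajectoryD(5)[OF trajectory]
  have t: "((\<lambda>r. F (y r) (u r)) has_integral (y t - y a)) {a..t}" using D[of t] st by auto
  have s: "((\<lambda>r. F (y r) (u r)) has_integral (y s - y a)) {a..s}" using D[of s] st by auto
  have "(\<lambda>r. F (y r) (u r)) integrable_on {s..t}"
    using t st by (auto intro: integrable_on_subinterval)
  then have "((\<lambda>r. F (y r) (u r)) has_integral integral {s..t} (\<lambda>r. F (y r) (u r))) {s..t}" by blast
  moreover from has_integral_combine[OF st(1,2) s this] t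
  have "y s - y a + integral {s..t} (\<lambda>r. F (y r) (u r)) = y t - y a"
    by (rule has_integral_unique)
  then have "integral {s..t} (\<lambda>r. F (y r) (u r)) = y t - y s" by (simp add: algebra_simps)
  ultimately show ?thesis by simp
qed

lemma trajectory_sub:
  assumes trajectory: "trajectory F a b u y" and st: "a \<le> s" "s \<le> t" "t \<le> b"
  shows "trajectory F s t u y"
proof -
  have sub: "{s..t} \<subseteq> {a..b}" using st by auto
  show ?thesis unfolding trajectory_def
    using trajectoryD[OF trajectory] sub st trajectory_increment[OF trajectory]
    by (auto intro: continuous_on_subset integrable_on_subinterval)
qed

lemma trajectory_const:
  assumes "a \<le> b" "F p 0 = 0"
  shows "trajectory F a b (\<lambda>_. 0) (\<lambda>_. p)"
  using assms by (auto simp: trajectory_def)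

section \<open>Concatenation in time\<close>

lemma has_integral_join:
  fixes f g :: "real \<Rightarrow> 'a::banach"
  assumes "(f has_integral i) {a..b}" "(g has_integral j) {b..c}" "a \<le> b" "b \<le> c"
  shows "((\<lambda>t. if t \<le> b then f t else g t) has_integral (i + j)) {a..c}"
proof (rule has_integral_combine[OF assms(3,4)])
  show "((\<lambda>t. if t \<le> b then f t else g t) has_integral i) {a..b}"
    using assms(1) by (subst has_integral_cong[where g=f]) auto
  show "((\<lambda>t. if t \<le> b then f t else g t) has_integral j) {b..c}"
    using assms(2) by (rule has_integral_spike_finite[where S="{b}", rotated 2]) auto
qed

lemma integrable_join:
  fixes f g :: "real \<Rightarrow> 'a::banach"
  assumes "f integrable_on {a..b}" "g integrable_on {b..c}" "a \<le> b" "b \<le> c"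
  shows "(\<lambda>t. if t \<le> b then f t else g t) integrable_on {a..c}"
  using has_integral_join[OF integrable_integral integrable_integral] assms by blast

lemma integral_join:
  fixes f g :: "real \<Rightarrow> 'a::banach"
  assumes "f integrable_on {a..b}" "g integrable_on {b..c}" "a \<le> b" "b \<le> c"
  shows "integral {a..c} (\<lambda>t. if t \<le> b then f t else g t) = integral {a..b} f + integral {b..c} g"
  using has_integral_join[OF integrable_integral integrable_integral] assms by blast

lemma trajectory_join:
  assumes 1: "trajectory F a b u y" and 2: "trajectory F b c v z" and eq: "y b = z b"
  shows "trajectory F a c (\<lambda>t. if t \<le> b then u t else v t) (\<lambda>t. if t \<le> b then y t else z t)"
proof -
  note D1 = trajectoryD[OF 1] and D2 = trajectoryD[OF 2]
  have "continuous_on ({a..b} \<union> {b..c}) (\<lambda>t. if t \<le> b then y t else z t)"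
    using D1(2) D2(2) eq by (intro continuous_on_If) (auto simp: antisym)
  moreover have "{a..b} \<union> {b..c} = {a..c}" using D1(1) D2(1) by auto
  moreover have "(\<lambda>t. (norm (if t \<le> b then u t else v t))\<^sup>2) integrable_on {a..c}"
    using integrable_join[OF D1(4) D2(4) D1(1) D2(1)] by (rule integrable_eq) auto
  moreover have "((\<lambda>s. F (if s \<le> b then y s else z s) (if s \<le> b then u s else v s)) has_integral
      ((if t \<le> b then y t else z t) - (if a \<le> b then y a else z a))) {a..t}" if t: "t \<in> {a..c}" for t
  proof (cases "t \<le> b")
    case True
    then show ?thesis using D1(5)[of t] D1(1) t
      by (subst has_integral_cong[where g="\<lambda>s. F (y s) (u s)"]) auto
  next
    case False
    then have "((\<lambda>s. if s \<le> b then F (y s) (u s) else F (z s) (v s)) has_integral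
        (y b - y a) + (z t - z b)) {a..t}"
      using D1(5)[of b] D2(5)[of t] D1(1) t by (intro has_integral_join) auto
    also have "(\<lambda>s. if s \<le> b then F (y s) (u s) else F (z s) (v s)) =
       (\<lambda>s. F (if s \<le> b then y s else z s) (if s \<le> b then u s else v s))" by auto
    finally show ?thesis using False D1(1) eq by simp
  qed
  ultimately show ?thesis
    unfolding trajectory_def using D1(1) D2(1) integrable_join[OF D1(3) D2(3) D1(1) D2(1)] by simp
qed

section \<open>Affine changes of time\<close>

lemma has_integral_rescale:
  fixes f :: "real \<Rightarrow> 'a::real_normed_vector"
  assumes "(f has_integral i) {a..b}" "k > 0"
  shows "((\<lambda>t. f (k * t + c)) has_integral (i /\<^sub>R k)) {(a - c) / k..(b - c) / k}"
  using has_integral_affinity'[of f i a b k c] assms by (simp add: divide_inverse_commute)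

text \<open>Homogeneity in the control turns the factor \<open>k\<close> on \<open>u\<close> into a
  factor \<open>k\<close> on the velocity, which cancels the \<open>1 / k\<close> of the
  substitution. Applied with \<open>k = 1 / 2\<close> to slow down and with \<open>k = 1\<close> to
  shift; here \<open>c\<close> is a time offset.\<close>

lemma trajectory_rescale:
  assumes trajectory: "trajectory F a b u y" and k: "k > 0"
    and homog: "\<And>y u. F y (k *\<^sub>R u) = k *\<^sub>R F y u"
  shows "trajectory F ((a - c) / k) ((b - c) / k) (\<lambda>t. k *\<^sub>R u (k * t + c)) (\<lambda>t. y (k * t + c))"
proof -
  note D = trajectoryD[OF trajectory]
  have range: "k * t + c \<in> {a..b}" if "t \<in> {(a - c) / k..(b - c) / k}" for t
    using that k by (auto simp: field_simps)
  have "(a - c) / k \<le> (b - c) / k" using D(1) k by (simp add: divide_right_mono)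
  moreover have "continuous_on {(a - c) / k..(b - c) / k} (\<lambda>t. y (k * t + c))"
    using range by (intro continuous_on_compose2[OF D(2)] continuous_intros) auto
  moreover have "(\<lambda>t. k *\<^sub>R u (k * t + c)) integrable_on {(a - c) / k..(b - c) / k}"
    using has_integral_rescale[OF integrable_integral[OF D(3)] k, of c] by (intro integrable_cmul) blast
  moreover have "(\<lambda>t. k\<^sup>2 *\<^sub>R (norm (u (k * t + c)))\<^sup>2) integrable_on {(a - c) / k..(b - c) / k}"
    using has_integral_rescale[OF integrable_integral[OF D(4)] k, of c] by (intro integrable_cmul) blast
  moreover have "((\<lambda>s. F (y (k * s + c)) (k *\<^sub>R u (k * s + c))) has_integral
      (y (k * t + c) - y (k * ((a - c) / k) + c))) {(a - c) / k..t}"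
    if t: "t \<in> {(a - c) / k..(b - c) / k}" for t
  proof -
    have "((\<lambda>s. k *\<^sub>R F (y (k * s + c)) (u (k * s + c))) has_integral
        k *\<^sub>R ((y (k * t + c) - y a) /\<^sub>R k)) {(a - c) / k..(k * t + c - c) / k}"
      by (intro has_integral_cmul has_integral_rescale D(5) range t k)
    then show ?thesis using k by (simp add: homog)
  qed
  ultimately show ?thesis
    unfolding trajectory_def using k by (simp add: power_mult_distrib)
qed

section \<open>Energies: squared L2 norms over an interval, for controls and for deviations\<close>

definition energy :: "real \<Rightarrow> real \<Rightarrow> (real \<Rightarrow> 'a::real_normed_vector) \<Rightarrow> real"
  where "energy a b w = integral {a..b} (\<lambda>t. (norm (w t))\<^sup>2)"

lemma energy_nonneg: "0 \<le> energy a b w"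
  unfolding energy_def
  \<comment> \<open>The integral of a nonintegrable function defaults to 0.\<close>
  by (cases "(\<lambda>t. (norm (w t))\<^sup>2) integrable_on {a..b}")
    (auto simp: not_integrable_integral intro: Henstock_Kurzweil_Integration.integral_nonneg)

lemma energy_split:
  assumes "(\<lambda>t. (norm (w t))\<^sup>2) integrable_on {a..b}" "a \<le> m" "m \<le> b"
  shows "energy a b w = energy a m w + energy m b w"
  unfolding energy_def using Henstock_Kurzweil_Integration.integral_combine assms by metis

lemma energy_mono:
  assumes "(\<lambda>t. (norm (w t))\<^sup>2) integrable_on {a..b}" "a \<le> a'" "b' \<le> b"
  shows "energy a' b' w \<le> energy a b w"
proof -
  have "{a'..b'} \<subseteq> {a..b}" using assms by auto
  then show ?thesis unfolding energy_def using assms(1)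
    by (intro integral_subset_le integrable_on_subinterval[OF assms(1)]) auto
qed

lemma energy_join:
  assumes "(\<lambda>t. (norm (v t))\<^sup>2) integrable_on {a..m}" "(\<lambda>t. (norm (w t))\<^sup>2) integrable_on {m..b}"
    "a \<le> m" "m \<le> b"
  shows "energy a b (\<lambda>t. if t \<le> m then v t else w t) = energy a m v + energy m b w"
  using integral_join[OF assms] unfolding energy_def
  by (simp add: if_distrib[of "\<lambda>x. (norm x)\<^sup>2"])

lemma energy_rescale:
  assumes "(\<lambda>t. (norm (w t))\<^sup>2) integrable_on {a..b}" "k > 0"
  shows "energy ((a - c) / k) ((b - c) / k) (\<lambda>t. w (k * t + c)) = energy a b w / k"
  using has_integral_rescale[OF integrable_integral[OF assms(1)] assms(2), of c]
  by (simp add: energy_def integral_unique divide_inverse_commute)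

lemma energy_scaleR: "energy a b (\<lambda>t. k *\<^sub>R w t) = k\<^sup>2 * energy a b w"
  by (simp add: energy_def power_mult_distrib)

lemma energy_const: "a \<le> b \<Longrightarrow> energy a b (\<lambda>_. p) = (b - a) * (norm p)\<^sup>2"
  by (simp add: energy_def)

text \<open>Gronwall in differential form: the integrating factor makes \<open>H\<close>
  nonincreasing. The rate \<open>B\<close> may have either sign; it is nonnegative for uniqueness
  and negative for decay.\<close>

lemma differential_inequality_bound:
  fixes G g :: "real \<Rightarrow> real"
  assumes deriv: "\<And>t. t \<in> {a..b} \<Longrightarrow> (G has_real_derivative g t) (at t within {a..b})"
    and le: "\<And>t. t \<in> {a..b} \<Longrightarrow> g t \<le> B * G t"
    and t: "t \<in> {a..b}"
  shows "G t \<le> G a * exp (B * (t - a))"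
proof -
  define H where "H s = exp (- (B * (s - a))) * G s" for s
  have deriv_H: "(H has_real_derivative exp (- (B * (s - a))) * (g s - B * G s)) (at s within {a..b})"
    if "s \<in> {a..b}" for s
  proof -
    have "((\<lambda>s. exp (- (B * (s - a)))) has_real_derivative - B * exp (- (B * (s - a)))) (at s within {a..b})"
      by (auto intro!: derivative_eq_intros)
    from DERIV_mult[OF this deriv[OF that]] show ?thesis
      unfolding H_def by (simp add: algebra_simps)
  qed
  have "H t \<le> H a"
  proof (rule DERIV_nonpos_imp_decreasing_open[where f=H])
    show "a \<le> t" using t by simp
    show "continuous_on {a..t} H"
      using DERIV_continuous_on[OF deriv_H] t by (auto intro: continuous_on_subset)
    fix s assume s: "a < s" "s < t"
    then have "(H has_real_derivative exp (- (B * (s - a))) * (g s - B * G s)) (at s)"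
      using deriv_H[of s] t by (simp add: at_within_Icc_at)
    moreover have "exp (- (B * (s - a))) * (g s - B * G s) \<le> 0"
      using le[of s] s t by (simp add: mult_nonneg_nonpos)
    ultimately show "\<exists>y. (H has_real_derivative y) (at s) \<and> y \<le> 0" by blast
  qed
  then have "exp (B * (t - a)) * H t \<le> exp (B * (t - a)) * H a" by simp
  moreover have "exp (B * (t - a)) * H t = G t"
    unfolding H_def mult.assoc[symmetric] exp_minus_inverse by simp
  moreover have "H a = G a" by (simp add: H_def)
  ultimately show ?thesis by (metis mult.commute)
qed

lemma le_one_plus_power2: "x \<le> 1 + x\<^sup>2" for x :: real
  using zero_le_power2[of "2 * x - 1"] by (simp add: power2_eq_square algebra_simps)

text \<open>Products are handled through absolute integrability: \<open>norm (u t)\<close> is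
  measurable and dominated by \<open>1 + (norm (u t))^2\<close>, and the continuous weight
  \<open>w\<close> is bounded on the compact interval.\<close>

lemma trajectory_speed_integrable:
  assumes tr: "trajectory F a b u y" and w: "continuous_on {a..b} w"
  shows "(\<lambda>t. w t * norm (u t)) integrable_on {a..b}"
proof -
  have "(\<lambda>t. norm (u t)) \<in> borel_measurable (lebesgue_on {a..b})"
    by (rule measurable_compose[OF integrable_imp_measurable[OF trajectoryD(3)[OF tr]] borel_measurable_norm])
  moreover have "(\<lambda>t. 1 + (norm (u t))\<^sup>2) integrable_on {a..b}"
    by (intro integrable_add trajectoryD(4)[OF tr] integrable_const_ivl)
  ultimately have "(\<lambda>t. norm (u t)) absolutely_integrable_on {a..b}"
    by (intro measurable_bounded_by_integrable_imp_absolutely_integrable[where g="\<lambda>t. 1 + (norm (u t))\<^sup>2"])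
      (auto simp: le_one_plus_power2)
  moreover have "bounded (w ` {a..b})"
    by (intro compact_imp_bounded compact_continuous_image w compact_Icc)
  moreover have "w \<in> borel_measurable (lebesgue_on {a..b})"
    by (intro continuous_imp_measurable_on_sets_lebesgue w) simp
  ultimately have "(\<lambda>t. w t * norm (u t)) absolutely_integrable_on {a..b}"
    by (intro absolutely_integrable_bounded_measurable_product_real) auto
  then show ?thesis by (simp add: absolutely_integrable_on_def)
qed

lemma trajectory_Cauchy_Schwarz:
  assumes tr: "trajectory F a b u y" and w: "continuous_on {a..b} w"
  shows "integral {a..b} (\<lambda>t. w t * norm (u t))
    \<le> sqrt (integral {a..b} (\<lambda>t. (w t)\<^sup>2)) * sqrt (integral {a..b} (\<lambda>t. (norm (u t))\<^sup>2))"
  by (intro integral_Cauchy_Schwarz trajectory_speed_integrable[OF tr w] trajectoryD(4)[OF tr]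
      integrable_continuous_real continuous_intros w)

lemma integrable_nonneg_lebesgue_on:
  fixes f :: "real \<Rightarrow> real"
  assumes "f integrable_on {a..b}" "\<And>t. t \<in> {a..b} \<Longrightarrow> 0 \<le> f t"
  shows "integrable (lebesgue_on {a..b}) f"
  using nonnegative_absolutely_integrable_1[OF assms]
  by (intro absolutely_integrable_imp_integrable) auto

section \<open>Driftless systems\<close>

text \<open>The properties of the dynamics on which the argument rests. Absence of drift appears as
  homogeneity in the control; one constant \<open>M\<close> serves both bounds, and \<open>c\<close>
  stands for the target point \<open>ybar\<close>.\<close>

locale driftless_system =
  fixes F :: "real^'d::finite \<Rightarrow> real^'m::finite \<Rightarrow> real^'d" and c :: "real^'d" and M :: real
  assumes M_pos: "0 < M"
    and homogeneous: "F y (k *\<^sub>R u) = k *\<^sub>R F y u"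
    and lipschitz: "norm (F y u - F z u) \<le> M * (norm (y - z) * norm u)"
    and growth: "norm (F y u) \<le> M * ((1 + norm (y - c)) * norm u)"
begin

lemma F_0: "F y 0 = 0"
  using homogeneous[of y 0 0] by simp

text \<open>Cauchy-Schwarz applied separately to the two summands of the growth bound. This is the
  passage from integral information to pointwise information.\<close>

lemma increment_bound:
  assumes tr: "trajectory F s t u y"
  shows "norm (y t - y s) \<le> M * (sqrt (t - s) + sqrt (energy s t (\<lambda>r. y r - c))) * sqrt (energy s t u)"
proof -
  let ?U = "integral {s..t} (\<lambda>r. (norm (u r))\<^sup>2)"
  note D = trajectoryD[OF tr]
  have 1: "(\<lambda>r. 1 * norm (u r)) integrable_on {s..t}"
    by (rule trajectory_speed_integrable[OF tr]) simp
  have 2: "(\<lambda>r. norm (y r - c) * norm (u r)) integrable_on {s..t}"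
    by (intro trajectory_speed_integrable[OF tr] continuous_intros D(2))
  have "((\<lambda>r. F (y r) (u r)) has_integral (y t - y s)) {s..t}"
    using D(1,5) by simp
  then have "norm (y t - y s) = norm (integral {s..t} (\<lambda>r. F (y r) (u r)))"
    by (simp add: integral_unique)
  also have "\<dots> \<le> integral {s..t} (\<lambda>r. M * (1 * norm (u r) + norm (y r - c) * norm (u r)))"
    using D(1,5) growth 1 2
    by (intro integral_norm_bound_integral integrable_on_mult_right integrable_add)
      (auto simp: algebra_simps)
  also have "\<dots> = M * (integral {s..t} (\<lambda>r. 1 * norm (u r)) + integral {s..t} (\<lambda>r. norm (y r - c) * norm (u r)))"
    using 1 2 by (simp only: integral_mult_right integral_add)
  also have "\<dots> \<le> M * (sqrt (integral {s..t} (\<lambda>r. 1\<^sup>2)) * sqrt ?U +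
      sqrt (integral {s..t} (\<lambda>r. (norm (y r - c))\<^sup>2)) * sqrt ?U)"
    using M_pos D(2)
    by (intro mult_left_mono add_mono trajectory_Cauchy_Schwarz[OF tr] continuous_intros) auto
  finally show ?thesis using D(1) by (simp add: energy_def algebra_simps)
qed

text \<open>Since \<open>u\<close> is only square integrable, Gronwall is applied to the integral of
  \<open>\<phi>\<close>, the squared distance: Cauchy-Schwarz moves the control into the constant
  \<open>U\<close>, leaving a constant rate.\<close>

lemma trajectory_unique:
  assumes y: "trajectory F a b u y" and z: "trajectory F a b u z"
    and eq: "y a = z a" and t: "t \<in> {a..b}"
  shows "y t = z t"
proof -
  define \<phi> where "\<phi> r = (norm (y r - z r))\<^sup>2" for r
  define U where "U = integral {a..b} (\<lambda>r. (norm (u r))\<^sup>2)"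
  have cont: "continuous_on {a..b} \<phi>"
    unfolding \<phi>_def by (intro continuous_intros trajectoryD(2)[OF y] trajectoryD(2)[OF z])
  have U_nonneg: "0 \<le> U" unfolding U_def
    by (intro Henstock_Kurzweil_Integration.integral_nonneg trajectoryD(4)[OF y]) auto
  have \<phi>_nonneg: "0 \<le> integral {a..s} \<phi>" if "s \<in> {a..b}" for s
    using that by (intro Henstock_Kurzweil_Integration.integral_nonneg integrable_continuous_real
        continuous_on_subset[OF cont]) (auto simp: \<phi>_def)
  have bound: "\<phi> s \<le> M\<^sup>2 * U * integral {a..s} \<phi>" if s: "s \<in> {a..b}" for s
  proof -
    have y': "trajectory F a s u y" and z': "trajectory F a s u z"
      using trajectory_sub[OF y] trajectory_sub[OF z] s by auto
    have w: "continuous_on {a..s} (\<lambda>r. norm (y r - z r))"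
      by (intro continuous_intros trajectoryD(2)[OF y'] trajectoryD(2)[OF z'])
    have "((\<lambda>r. F (y r) (u r) - F (z r) (u r)) has_integral (y s - y a) - (z s - z a)) {a..s}"
      using s by (intro has_integral_diff trajectoryD(5)[OF y] trajectoryD(5)[OF z])
    then have int: "((\<lambda>r. F (y r) (u r) - F (z r) (u r)) has_integral (y s - z s)) {a..s}"
      using eq by simp
    then have "norm (y s - z s) = norm (integral {a..s} (\<lambda>r. F (y r) (u r) - F (z r) (u r)))"
      by (simp add: integral_unique)
    also have "\<dots> \<le> integral {a..s} (\<lambda>r. M * (norm (y r - z r) * norm (u r)))"
      using int lipschitz
      by (intro integral_norm_bound_integral integrable_on_mult_right
          trajectory_speed_integrable[OF y' w]) auto
    also have "\<dots> = M * integral {a..s} (\<lambda>r. norm (y r - z r) * norm (u r))"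
      by (rule integral_mult_right)
    also have "\<dots> \<le> M * (sqrt (integral {a..s} \<phi>) * sqrt (integral {a..s} (\<lambda>r. (norm (u r))\<^sup>2)))"
      unfolding \<phi>_def using M_pos by (intro mult_left_mono trajectory_Cauchy_Schwarz[OF y' w]) auto
    also have "\<dots> \<le> M * (sqrt (integral {a..s} \<phi>) * sqrt U)"
      unfolding U_def using M_pos s trajectoryD(4)[OF y] trajectoryD(4)[OF y']
      by (intro mult_left_mono real_sqrt_le_mono integral_subset_le) (auto intro: \<phi>_nonneg)
    finally have "(norm (y s - z s))\<^sup>2 \<le> (M * (sqrt (integral {a..s} \<phi>) * sqrt U))\<^sup>2"
      by (intro power_mono) auto
    with \<phi>_nonneg U_nonneg s show ?thesis by (simp add: \<phi>_def power_mult_distrib mult_ac)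
  qed
  have "integral {a..t} \<phi> \<le> integral {a..a} \<phi> * exp (M\<^sup>2 * U * (t - a))"
    by (rule differential_inequality_bound[where g=\<phi> and b=b])
      (use bound t integral_has_real_derivative[OF cont] in auto)
  then have "integral {a..t} \<phi> \<le> 0" by simp
  then have "M\<^sup>2 * U * integral {a..t} \<phi> \<le> 0"
    using U_nonneg by (intro mult_nonneg_nonpos) auto
  with bound[OF t] have "\<phi> t \<le> 0" by simp
  then show ?thesis by (simp add: \<phi>_def)
qed

section \<open>From Lebesgue solutions to trajectories and back\<close>

lemma solution_imp_trajectory:
  assumes u: "u \<in> L2 T" and sol: "is_solution F T y0 u y" and T: "0 \<le> T"
  shows "trajectory F 0 T u y" and "y 0 = y0"
proof -
  from u have meas: "u \<in> borel_measurable (lebesgue_on {0..T})"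
    and sq: "(\<lambda>t. (norm (u t))\<^sup>2) integrable_on {0..T}"
    by (auto simp: L2_def intro: integrable_on_lebesgue_on)
  have "(\<lambda>t. 1 + (norm (u t))\<^sup>2) integrable_on {0..T}"
    by (intro integrable_add sq integrable_const_ivl)
  then have int: "u integrable_on {0..T}"
    by (rule measurable_bounded_by_integrable_imp_integrable[OF meas]) (auto simp: le_one_plus_power2)
  from sol have int_F: "integrable (lebesgue_on {0..T}) (\<lambda>s. F (y s) (u s))"
    and y: "\<And>t. t \<in> {0..T} \<Longrightarrow> y t = y0 + (\<integral>s. F (y s) (u s) \<partial>(lebesgue_on {0..t}))"
    and cont: "continuous_on {0..T} y"
    unfolding is_solution_def by blast+
  have *: "((\<lambda>s. F (y s) (u s)) has_integral (y t - y0)) {0..t}" if t: "t \<in> {0..T}" for t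
  proof -
    have "integrable (lebesgue_on {0..t}) (\<lambda>s. F (y s) (u s))"
      using integrable_subinterval[OF int_F, of 0 t] t by auto
    then show ?thesis
      using has_integral_integral_lebesgue_on[of "{0..t}" "\<lambda>s. F (y s) (u s)"] y[OF t] by simp
  qed
  \<comment> \<open>The integral equation at time 0 identifies the initial value.\<close>
  have "((\<lambda>s. F (y s) (u s)) has_integral 0) {0..0}"
    using has_integral_refl(2) by simp
  from has_integral_unique[OF *[of 0] this] have "y 0 - y0 = 0" using T by simp
  then show 0: "y 0 = y0" by simp
  show "trajectory F 0 T u y"
    using T cont int sq * 0 by (simp add: trajectory_def)
qed

lemma trajectory_L2:
  assumes tr: "trajectory F 0 T u y"
  shows "u \<in> L2 T"
  unfolding L2_def using trajectoryD(3,4)[OF tr]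
  by (auto intro: integrable_imp_measurable integrable_nonneg_lebesgue_on)

text \<open>Lebesgue integrability of the velocity comes from domination by the growth bound, since
  gauge integrability alone does not give it.\<close>

lemma trajectory_imp_solution:
  assumes tr: "trajectory F 0 T u y"
  shows "is_solution F T (y 0) u y"
proof -
  note D = trajectoryD[OF tr]
  have w: "continuous_on {0..T} (\<lambda>t. 1 + norm (y t - c))" by (intro continuous_intros D(2))
  have int: "integrable (lebesgue_on {0..T}) (\<lambda>s. F (y s) (u s))"
  proof (rule measurable_bounded_by_integrable_imp_lebesgue_integrable)
    show "(\<lambda>s. F (y s) (u s)) \<in> borel_measurable (lebesgue_on {0..T})"
      using D(5)[of T] D(1) by (intro integrable_imp_measurable) auto
    show "integrable (lebesgue_on {0..T}) (\<lambda>t. M * ((1 + norm (y t - c)) * norm (u t)))"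
      using M_pos by (intro integrable_nonneg_lebesgue_on integrable_on_mult_right
          trajectory_speed_integrable[OF tr w]) auto
  qed (use growth in auto)
  have "y t = y 0 + (\<integral>s. F (y s) (u s) \<partial>(lebesgue_on {0..t}))" if t: "t \<in> {0..T}" for t
  proof -
    have "integrable (lebesgue_on {0..t}) (\<lambda>s. F (y s) (u s))"
      using integrable_subinterval[OF int, of 0 t] t by auto
    then show ?thesis
      using D(5)[OF t] by (simp add: lebesgue_integral_eq_integral integral_unique)
  qed
  then show ?thesis unfolding is_solution_def using D(2) int by blast
qed

text \<open>By uniqueness, the solution picked by the choice operator in \<open>state\<close> agrees
  with \<open>y\<close> on \<open>[0, T]\<close>, so the cost may be computed along
  \<open>y\<close>.\<close>

lemma cost_trajectory:
  assumes tr: "trajectory F 0 T u y"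
  shows "cost F (y 0) c T u = energy 0 T (\<lambda>t. y t - c) + energy 0 T u"
proof -
  have T: "0 \<le> T" using trajectoryD(1)[OF tr] .
  have "is_solution F T (y 0) u (state F T (y 0) u)"
    unfolding state_def by (rule someI[of "is_solution F T (y 0) u"]) (rule trajectory_imp_solution[OF tr])
  from solution_imp_trajectory[OF trajectory_L2[OF tr] this T]
  have "state F T (y 0) u t = y t" if "t \<in> {0..T}" for t
    using trajectory_unique[OF _ tr _ that] by simp
  then have "(\<integral>t. (norm (state F T (y 0) u t - c))\<^sup>2 \<partial>(lebesgue_on {0..T})) =
      (\<integral>t. (norm (y t - c))\<^sup>2 \<partial>(lebesgue_on {0..T}))"
    by (intro Bochner_Integration.integral_cong) auto
  then show ?thesis
    unfolding cost_def energy_def using trajectoryD(4)[OF tr] trajectory_dist_integrable[OF tr]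
    by (simp add: lebesgue_integral_eq_integral integrable_nonneg_lebesgue_on)
qed

section \<open>Optimal trajectories\<close>

definition total_cost :: "real \<Rightarrow> real \<Rightarrow> (real \<Rightarrow> real^'m) \<Rightarrow> (real \<Rightarrow> real^'d) \<Rightarrow> real"
  where "total_cost a b u y = energy a b (\<lambda>t. y t - c) + energy a b u"

text \<open>Minimality is over explicit pairs \<open>(v, z)\<close>, so every comparison below
  supplies its own state instead of going through \<open>state\<close>.\<close>

definition optimal :: "real \<Rightarrow> (real \<Rightarrow> real^'m) \<Rightarrow> (real \<Rightarrow> real^'d) \<Rightarrow> bool"
  where "optimal T u y \<longleftrightarrow> trajectory F 0 T u y \<and>
    (\<forall>v z. trajectory F 0 T v z \<longrightarrow> z 0 = y 0 \<longrightarrow> total_cost 0 T u y \<le> total_cost 0 T v z)"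

lemma total_cost_nonneg: "0 \<le> total_cost a b u y"
  by (simp add: total_cost_def energy_nonneg)

lemma total_cost_split:
  assumes "trajectory F a b u y" "a \<le> m" "m \<le> b"
  shows "total_cost a b u y = total_cost a m u y + total_cost m b u y"
  using energy_split[OF trajectory_dist_integrable[OF assms(1)] assms(2,3)]
    energy_split[OF trajectoryD(4)[OF assms(1)] assms(2,3)]
  by (simp add: total_cost_def)

lemma total_cost_join:
  assumes "trajectory F a b u y" "trajectory F b d v z"
  shows "total_cost a d (\<lambda>t. if t \<le> b then u t else v t) (\<lambda>t. if t \<le> b then y t else z t)
    = total_cost a b u y + total_cost b d v z"
  using energy_join[OF trajectory_dist_integrable[OF assms(1), of c] trajectory_dist_integrable[OF assms(2)]]
    energy_join[OF trajectoryD(4)[OF assms(1)] trajectoryD(4)[OF assms(2)]]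
    trajectoryD(1)[OF assms(1)] trajectoryD(1)[OF assms(2)]
  by (simp add: total_cost_def if_distrib[of "\<lambda>x. x - c"])

lemma total_cost_rescale:
  assumes "trajectory F a b u y" "k > 0"
  shows "total_cost ((a - r) / k) ((b - r) / k) (\<lambda>t. k *\<^sub>R u (k * t + r)) (\<lambda>t. y (k * t + r))
    = energy a b (\<lambda>t. y t - c) / k + k * energy a b u"
  using energy_rescale[OF trajectory_dist_integrable[OF assms(1)] assms(2)]
    energy_rescale[OF trajectoryD(4)[OF assms(1)] assms(2)] assms(2)
  by (simp add: total_cost_def energy_scaleR power2_eq_square)

lemma total_cost_const: "a \<le> b \<Longrightarrow> total_cost a b (\<lambda>_. 0) (\<lambda>_. p) = (b - a) * (norm (p - c))\<^sup>2"
  by (simp add: total_cost_def energy_const)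

lemma minimizer_optimal:
  assumes min: "global_minimizer F y0 c T u" and sol: "is_solution F T y0 u y" and T: "0 \<le> T"
  shows "optimal T u y" and "y 0 = y0"
proof -
  from min have u: "u \<in> L2 T" by (simp add: global_minimizer_def)
  note y = solution_imp_trajectory[OF u sol T]
  show "y 0 = y0" by (rule y(2))
  have "total_cost 0 T u y \<le> total_cost 0 T v z" if tr: "trajectory F 0 T v z" and z0: "z 0 = y 0" for v z
  proof -
    have "cost F y0 c T u \<le> cost F y0 c T v"
      using min trajectory_L2[OF tr] by (auto simp: global_minimizer_def)
    then show ?thesis
      using cost_trajectory[OF y(1)] cost_trajectory[OF tr] y(2) z0 by (simp add: total_cost_def)
  qed
  then show "optimal T u y" using y(1) by (simp add: optimal_def)
qed

text \<open>Dynamic programming: a competitor on \<open>[\<tau>, T]\<close> is glued to the optimal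
  pair on \<open>[0, \<tau>]\<close>, and the common cost of the head cancels.\<close>

lemma optimal_tail:
  assumes opt: "optimal T u y" and \<tau>: "0 \<le> \<tau>" "\<tau> \<le> T"
    and tr: "trajectory F \<tau> T v z" and eq: "z \<tau> = y \<tau>"
  shows "total_cost \<tau> T u y \<le> total_cost \<tau> T v z"
proof -
  from opt have y: "trajectory F 0 T u y" by (simp add: optimal_def)
  have y1: "trajectory F 0 \<tau> u y" using trajectory_sub[OF y] \<tau> by simp
  have "total_cost 0 T u y \<le> total_cost 0 T (\<lambda>t. if t \<le> \<tau> then u t else v t) (\<lambda>t. if t \<le> \<tau> then y t else z t)"
    using opt trajectory_join[OF y1 tr eq[symmetric]] \<tau> by (simp add: optimal_def)
  then show ?thesis
    using total_cost_join[OF y1 tr] total_cost_split[OF y \<tau>] by simp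
qed

text \<open>Half speed doubles the deviation energy \<open>X\<close> of the piece and halves its
  control energy \<open>U\<close>. Everything later is at most as costly as before, so
  \<open>X + U \<le> 2 X + U / 2\<close>.\<close>

lemma optimal_energy_le:
  assumes opt: "optimal T u y" and ah: "0 \<le> a" "0 < h" "a + 2 * h \<le> T"
  shows "energy a (a + h) u \<le> 2 * energy a (a + h) (\<lambda>t. y t - c)"
proof -
  from opt have y: "trajectory F 0 T u y" by (simp add: optimal_def)
  have y1: "trajectory F a (a + h) u y" and y2: "trajectory F (a + h) (T - h) u y"
    and y3: "trajectory F a T u y" and y4: "trajectory F (a + h) T u y"
    using ah by (auto intro: trajectory_sub[OF y])
  \<comment> \<open>Half-speed replay; the offset \<open>a / 2\<close> keeps time \<open>a\<close>
    fixed.\<close>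
  define v1 z1 where "v1 = (\<lambda>t. (1/2) *\<^sub>R u ((1/2) * t + a / 2))" and "z1 = (\<lambda>t. y ((1/2) * t + a / 2))"
  \<comment> \<open>The rest, delayed by \<open>h\<close>; the explicit factor 1 matches the form of
    \<open>trajectory_rescale\<close>.\<close>
  define v2 z2 where "v2 = (\<lambda>t. 1 *\<^sub>R u (1 * t + (- h)))" and "z2 = (\<lambda>t. y (1 * t + (- h)))"
  have slow: "trajectory F a (a + 2 * h) v1 z1"
    using trajectory_rescale[OF y1, of "1/2" "a/2"] homogeneous
    by (simp add: v1_def z1_def algebra_simps)
  have shift: "trajectory F (a + 2 * h) T v2 z2"
    using trajectory_rescale[OF y2, of 1 "-h"]
    by (simp add: v2_def z2_def algebra_simps)
  \<comment> \<open>Both sides are \<open>y\<close> at time \<open>a + h\<close>.\<close>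
  have meet: "z1 (a + 2 * h) = z2 (a + 2 * h)"
    unfolding z1_def z2_def by (rule arg_cong[of _ _ y]) (simp add: field_simps)
  have start: "z1 a = y a" by (simp add: z1_def)
  have "total_cost a T u y \<le> total_cost a T (\<lambda>t. if t \<le> a + 2 * h then v1 t else v2 t)
      (\<lambda>t. if t \<le> a + 2 * h then z1 t else z2 t)"
    using ah start by (intro optimal_tail[OF opt] trajectory_join[OF slow shift] meet) auto
  also have "\<dots> = total_cost a (a + 2 * h) v1 z1 + total_cost (a + 2 * h) T v2 z2"
    by (rule total_cost_join[OF slow shift])
  also have "total_cost a (a + 2 * h) v1 z1 = 2 * energy a (a + h) (\<lambda>t. y t - c) + energy a (a + h) u / 2"
    using total_cost_rescale[OF y1, of "1/2" "a/2"] by (simp add: v1_def z1_def algebra_simps)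
  also have "total_cost (a + 2 * h) T v2 z2 = total_cost (a + h) (T - h) u y"
    using total_cost_rescale[OF y2, of 1 "-h"]
    by (simp add: v2_def z2_def total_cost_def algebra_simps)
  finally have "total_cost a T u y \<le> 2 * energy a (a + h) (\<lambda>t. y t - c) + energy a (a + h) u / 2
      + total_cost (a + h) (T - h) u y" .
  moreover have "total_cost a T u y = total_cost a (a + h) u y + total_cost (a + h) T u y"
    using ah by (intro total_cost_split[OF y3]) auto
  moreover have "total_cost (a + h) T u y = total_cost (a + h) (T - h) u y + total_cost (T - h) T u y"
    using ah by (intro total_cost_split[OF y4]) auto
  moreover have "0 \<le> total_cost (T - h) T u y" by (rule total_cost_nonneg)
  ultimately show ?thesis by (simp add: total_cost_def[of a "a + h"])
qed

lemma optimal_control_le: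
  assumes opt: "optimal T u y"
  shows "AE t in lebesgue_on {0..T}. (norm (u t))\<^sup>2 \<le> 2 * (norm (y t - c))\<^sup>2"
proof -
  from opt have y: "trajectory F 0 T u y" by (simp add: optimal_def)
  let ?g = "\<lambda>t. (norm (u t))\<^sup>2 - 2 * (norm (y t - c))\<^sup>2"
  have "AE t in lebesgue_on {0..T}. ?g t \<le> 0"
  proof (rule AE_nonpos_if_interval_integrals_nonpos)
    show "?g integrable_on {0..T}"
      by (intro integrable_diff integrable_on_mult_right trajectoryD(4)[OF y] trajectory_dist_integrable[OF y])
    fix a h :: real assume ah: "0 \<le> a" "0 < h" "a + 2 * h \<le> T"
    have y': "trajectory F a (a + h) u y" using ah by (intro trajectory_sub[OF y]) auto
    have "integral {a..a + h} ?g = energy a (a + h) u - 2 * energy a (a + h) (\<lambda>t. y t - c)"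
      unfolding energy_def
      by (subst Henstock_Kurzweil_Integration.integral_diff)
        (auto intro!: integrable_on_mult_right trajectoryD(4)[OF y'] trajectory_dist_integrable[OF y'])
    then show "integral {a..a + h} ?g \<le> 0" using optimal_energy_le[OF opt ah] by simp
  qed
  then show ?thesis by eventually_elim simp
qed

text \<open>The competitor runs the steering control from time \<open>\<tau>\<close> on and then
  rests at \<open>c\<close> at no cost, so the bound does not grow with \<open>T\<close>.\<close>

lemma optimal_steer:
  assumes opt: "optimal T u y" and \<tau>: "0 \<le> \<tau>" "\<tau> + T0 \<le> T"
    and tr: "trajectory F 0 T0 v z" and z: "z 0 = y \<tau>" "z T0 = c"
  shows "total_cost \<tau> T u y \<le> total_cost 0 T0 v z"
proof -
  define v' z' where "v' = (\<lambda>t. 1 *\<^sub>R v (1 * t + (- \<tau>)))" and "z' = (\<lambda>t. z (1 * t + (- \<tau>)))"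
  have tr': "trajectory F \<tau> (\<tau> + T0) v' z'"
    using trajectory_rescale[OF tr, of 1 "- \<tau>"] by (simp add: v'_def z'_def algebra_simps)
  have const: "trajectory F (\<tau> + T0) T (\<lambda>_. 0) (\<lambda>_. c)"
    using \<tau> by (intro trajectory_const F_0)
  have "total_cost \<tau> T u y \<le> total_cost \<tau> T (\<lambda>t. if t \<le> \<tau> + T0 then v' t else 0)
      (\<lambda>t. if t \<le> \<tau> + T0 then z' t else c)"
    using \<tau> z trajectoryD(1)[OF tr]
    by (intro optimal_tail[OF opt] trajectory_join[OF tr' const]) (auto simp: z'_def)
  also have "\<dots> = total_cost \<tau> (\<tau> + T0) v' z' + total_cost (\<tau> + T0) T (\<lambda>_. 0) (\<lambda>_. c)"
    by (rule total_cost_join[OF tr' const])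
  also have "\<dots> = total_cost 0 T0 v z"
    using total_cost_rescale[OF tr, of 1 "- \<tau>"] \<tau>
    by (simp add: v'_def z'_def total_cost_const total_cost_def[of 0] algebra_simps)
  finally show ?thesis .
qed

lemma optimal_wait:
  assumes opt: "optimal T u y" and \<tau>: "0 \<le> \<tau>" "\<tau> \<le> T"
  shows "total_cost \<tau> T u y \<le> (T - \<tau>) * (norm (y \<tau> - c))\<^sup>2"
  using optimal_tail[OF opt \<tau> trajectory_const[where F=F and p="y \<tau>", OF \<tau>(2) F_0]] \<tau>(2)
  by (simp add: total_cost_const)

text \<open>An absorption argument at the time \<open>m\<close> of largest deviation
  \<open>R\<close>: the increment bound on \<open>[0, m]\<close> contains \<open>R\<close> with a
  coefficient that \<open>small\<close> keeps below \<open>1 / 2\<close>, so that term moves to the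
  left-hand side.\<close>

lemma small_energy_trajectory_bound:
  assumes tr: "trajectory F 0 T u y"
    and U: "sqrt (energy 0 T u) \<le> k * norm (y 0 - c)"
    and small: "M * sqrt T * k * norm (y 0 - c) \<le> 1 / 2" and t: "t \<in> {0..T}"
  shows "norm (y t - c) \<le> 2 * (1 + M * sqrt T * k) * norm (y 0 - c)"
proof -
  note D = trajectoryD[OF tr]
  let ?x = "norm (y 0 - c)"
  have "continuous_on {0..T} (\<lambda>t. norm (y t - c))" by (intro continuous_intros D(2))
  then obtain m where m: "m \<in> {0..T}" and max: "\<And>t. t \<in> {0..T} \<Longrightarrow> norm (y t - c) \<le> norm (y m - c)"
    using continuous_attains_sup[of "{0..T}" "\<lambda>t. norm (y t - c)"] D(1) by auto
  define R where "R = norm (y m - c)"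
  have trm: "trajectory F 0 m u y" using trajectory_sub[OF tr] m by simp
  have "energy 0 m (\<lambda>t. y t - c) \<le> integral {0..m} (\<lambda>t. R\<^sup>2)"
    unfolding energy_def using m max
    by (intro integral_le trajectory_dist_integrable[OF trm]) (auto simp: R_def intro!: power_mono)
  also have "\<dots> \<le> T * R\<^sup>2" using m by (simp add: mult_right_mono)
  finally have X: "sqrt (energy 0 m (\<lambda>t. y t - c)) \<le> sqrt T * R"
    using real_sqrt_le_mono by (fastforce simp: real_sqrt_mult R_def)
  have "sqrt (energy 0 m u) \<le> sqrt (energy 0 T u)"
    using m by (intro real_sqrt_le_mono energy_mono D(4)) auto
  with U have Um: "sqrt (energy 0 m u) \<le> k * ?x" by linarith
  have "R \<le> ?x + norm (y m - y 0)"
    using norm_triangle_ineq[of "y 0 - c" "y m - y 0"] by (simp add: R_def)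
  also have "norm (y m - y 0) \<le> M * (sqrt (m - 0) + sqrt (energy 0 m (\<lambda>t. y t - c))) * sqrt (energy 0 m u)"
    by (rule increment_bound[OF trm])
  also have "\<dots> \<le> M * (sqrt T + sqrt T * R) * (k * ?x)"
    using M_pos m X Um D(1) by (intro mult_mono add_mono mult_nonneg_nonneg add_nonneg_nonneg)
      (auto simp: R_def energy_nonneg)
  also have "\<dots> = M * sqrt T * k * ?x + (M * sqrt T * k * ?x) * R"
    by (simp add: algebra_simps)
  also have "(M * sqrt T * k * ?x) * R \<le> (1 / 2) * R"
    using small by (intro mult_right_mono) (auto simp: R_def)
  finally have "R \<le> 2 * (1 + M * sqrt T * k) * ?x" by (simp add: algebra_simps)
  then show ?thesis using max[OF t] by (simp add: R_def)
qed

section \<open>Exponential decay\<close>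

lemma steers_trajectory:
  assumes "steers F T a b u" "0 \<le> T"
  obtains y where "trajectory F 0 T u y" "y 0 = a" "y T = b"
  using assms solution_imp_trajectory unfolding steers_def by metis

text \<open>Doubling the constant in the infimum estimate yields an actual control. Its smallness
  also bounds the state deviation linearly, so both parts of the cost are quadratic in the initial
  deviation.\<close>

lemma local_steering_cost:
  assumes ctrl: "controllable_with_local_cost F T0 c" and T0: "0 < T0"
  obtains \<rho> K where "0 < \<rho>" "0 < K"
    "\<And>p. norm (p - c) \<le> \<rho> \<Longrightarrow> \<exists>u z. trajectory F 0 T0 u z \<and> z 0 = p \<and> z T0 = c \<and>
      total_cost 0 T0 u z \<le> K * (norm (p - c))\<^sup>2"
proof -
  from ctrl obtain r L where r: "0 < r" and L: "0 < L"
    and inf: "\<And>p. p \<in> cball c r \<Longrightarrow> (INF u\<in>{u. steers F T0 p c u}. L2_norm T0 u) \<le> L * norm (p - c)"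
    and ex: "\<And>p q. \<exists>u. steers F T0 p q u"
    unfolding controllable_with_local_cost_def by (meson centre_in_cball less_imp_le)
  \<comment> \<open>This is \<open>M * sqrt T * k\<close> of
    \<open>small_energy_trajectory_bound\<close> for \<open>k = 2 * L\<close>; the radius
    \<open>1 / (2 * q)\<close> below then ensures its smallness condition.\<close>
  define q where "q = M * sqrt T0 * (2 * L)"
  have q: "0 < q" using M_pos T0 L by (simp add: q_def)
  define K where "K = T0 * (2 * (1 + q))\<^sup>2 + (2 * L)\<^sup>2"
  have K: "0 < K" using L T0 by (auto simp: K_def intro!: add_nonneg_pos)
  have "\<exists>u z. trajectory F 0 T0 u z \<and> z 0 = p \<and> z T0 = c \<and> total_cost 0 T0 u z \<le> K * (norm (p - c))\<^sup>2"
    if p: "norm (p - c) \<le> min r (1 / (2 * q))" for p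
  \<comment> \<open>For \<open>p = c\<close> doubling leaves no strict gap above the infimum, so
    resting at \<open>c\<close> is used instead.\<close>
  proof (cases "p = c")
    case True
    have "trajectory F 0 T0 (\<lambda>_. 0) (\<lambda>_. c)" using T0 by (intro trajectory_const F_0) simp
    moreover have "total_cost 0 T0 (\<lambda>_. 0) (\<lambda>_. c) \<le> K * (norm (p - c))\<^sup>2"
      using T0 True by (simp add: total_cost_const)
    ultimately show ?thesis using True by blast
  next
    case False
    then have pos: "0 < norm (p - c)" by simp
    have "p \<in> cball c r" using p by (simp add: dist_norm norm_minus_commute)
    moreover have "L * norm (p - c) < 2 * L * norm (p - c)" using L pos by simp
    ultimately have "(INF u\<in>{u. steers F T0 p c u}. L2_norm T0 u) < 2 * L * norm (p - c)"
      using inf by (blast intro: le_less_trans)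
    moreover have "bdd_below (L2_norm T0 ` {u. steers F T0 p c u})"
      by (rule bdd_belowI[of _ 0]) (auto simp: L2_norm_def)
    ultimately obtain u where u: "steers F T0 p c u" and small: "L2_norm T0 u < 2 * L * norm (p - c)"
      using cINF_less_iff[of "{u. steers F T0 p c u}" "L2_norm T0"] ex by auto
    obtain z where z: "trajectory F 0 T0 u z" "z 0 = p" "z T0 = c"
      using steers_trajectory[OF u] T0 by auto
    note D = trajectoryD[OF z(1)]
    have "L2_norm T0 u = sqrt (energy 0 T0 u)"
      using D(4) by (simp add: L2_norm_def energy_def lebesgue_integral_eq_integral integrable_nonneg_lebesgue_on)
    then have U: "sqrt (energy 0 T0 u) \<le> 2 * L * norm (z 0 - c)" using small z by simp
    have "q * norm (p - c) \<le> q * (1 / (2 * q))" using p q by (intro mult_left_mono) auto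
    also have "q * (1 / (2 * q)) = 1 / 2" using q by simp
    finally have "M * sqrt T0 * (2 * L) * norm (z 0 - c) \<le> 1 / 2" using z by (simp add: q_def)
    from small_energy_trajectory_bound[OF z(1) U this]
    have bound: "norm (z t - c) \<le> 2 * (1 + q) * norm (p - c)" if "t \<in> {0..T0}" for t
      using that z by (simp add: q_def)
    have "energy 0 T0 (\<lambda>t. z t - c) \<le> integral {0..T0} (\<lambda>t. (2 * (1 + q) * norm (p - c))\<^sup>2)"
      unfolding energy_def
      by (intro integral_le trajectory_dist_integrable[OF z(1)] power_mono bound) auto
    then have "energy 0 T0 (\<lambda>t. z t - c) \<le> T0 * (2 * (1 + q))\<^sup>2 * (norm (p - c))\<^sup>2"
      using T0 by (simp add: power_mult_distrib mult_ac)
    moreover have "energy 0 T0 u \<le> (2 * L)\<^sup>2 * (norm (p - c))\<^sup>2"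
      using power_mono[OF U, of 2] z(2) by (simp add: energy_nonneg power_mult_distrib)
    ultimately have "total_cost 0 T0 u z \<le> K * (norm (p - c))\<^sup>2"
      by (simp add: total_cost_def K_def distrib_right)
    then show ?thesis using z by blast
  qed
  moreover have "0 < min r (1 / (2 * q))" using r q by simp
  ultimately show thesis using that K by blast
qed

lemma optimal_tail_le_deviation:
  assumes ctrl: "controllable_with_local_cost F T0 c" and T0: "0 < T0"
  obtains K V where "0 < K" "0 < V"
    "\<And>T u y. optimal T u y \<Longrightarrow> y 0 = y0 \<Longrightarrow> T0 \<le> T \<Longrightarrow> total_cost 0 T u y \<le> V"
    "\<And>T u y t. optimal T u y \<Longrightarrow> y 0 = y0 \<Longrightarrow> T0 \<le> T \<Longrightarrow> t \<in> {0..T} \<Longrightarrow>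
      total_cost t T u y \<le> K * (norm (y t - c))\<^sup>2"
proof -
  obtain \<rho> L where \<rho>: "0 < \<rho>" and L: "0 < L"
    and steer: "\<And>p. norm (p - c) \<le> \<rho> \<Longrightarrow> \<exists>u z. trajectory F 0 T0 u z \<and> z 0 = p \<and> z T0 = c \<and>
      total_cost 0 T0 u z \<le> L * (norm (p - c))\<^sup>2"
    using local_steering_cost[OF ctrl T0] by blast
  from ctrl obtain w where "steers F T0 y0 c w"
    unfolding controllable_with_local_cost_def by blast
  then obtain x where x: "trajectory F 0 T0 w x" "x 0 = y0" "x T0 = c"
    using steers_trajectory T0 by (metis less_imp_le)
  \<comment> \<open>The added 1 makes \<open>V\<close> positive.\<close>
  define V where "V = total_cost 0 T0 w x + 1"
  have V: "0 < V" using total_cost_nonneg[of 0 T0 w x] by (simp add: V_def)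
  \<comment> \<open>One summand per case below: waiting near the final time, steering from within
    radius \<open>\<rho>\<close>, and comparing \<open>V\<close> with a deviation larger than
    \<open>\<rho>\<close>.\<close>
  define K where "K = T0 + L + V / \<rho>\<^sup>2"
  have K: "0 < K" using T0 L V by (simp add: K_def add_pos_nonneg)
  have KT0: "T0 \<le> K" and KL: "L \<le> K" and KV: "V / \<rho>\<^sup>2 \<le> K" using T0 L V by (simp_all add: K_def)
  have V_bound: "total_cost 0 T u y \<le> V" if "optimal T u y" "y 0 = y0" "T0 \<le> T" for T u y
    using optimal_steer[OF that(1) order_refl _ x(1)] x that(2,3) by (simp add: V_def)
  have "total_cost t T u y \<le> K * (norm (y t - c))\<^sup>2"
    if opt: "optimal T u y" and y0: "y 0 = y0" and T: "T0 \<le> T" and t: "t \<in> {0..T}" for T u y t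
  proof -
    let ?x2 = "(norm (y t - c))\<^sup>2"
    from opt have tr: "trajectory F 0 T u y" by (simp add: optimal_def)
    consider "T - t \<le> T0" | "t + T0 \<le> T" "norm (y t - c) \<le> \<rho>" | "\<rho> < norm (y t - c)" by linarith
    then show ?thesis
    proof cases
      case 1
      have "total_cost t T u y \<le> (T - t) * ?x2" using optimal_wait[OF opt] t by simp
      also have "\<dots> \<le> K * ?x2" using 1 KT0 by (intro mult_right_mono) auto
      finally show ?thesis .
    next
      case 2
      then obtain v z where v: "trajectory F 0 T0 v z" "z 0 = y t" "z T0 = c"
        "total_cost 0 T0 v z \<le> L * ?x2" using steer by blast
      have "total_cost t T u y \<le> total_cost 0 T0 v z"
        using optimal_steer[OF opt _ 2(1) v(1,2,3)] t by simp
      also have "\<dots> \<le> L * ?x2" by (rule v(4))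
      also have "\<dots> \<le> K * ?x2" using KL by (intro mult_right_mono) auto
      finally show ?thesis .
    next
      case 3
      have "total_cost t T u y \<le> total_cost 0 T u y"
        using total_cost_split[OF tr, of t] total_cost_nonneg[of 0 t u y] t by simp
      also have "\<dots> \<le> V" by (rule V_bound[OF opt y0 T])
      also have "\<dots> = V / \<rho>\<^sup>2 * \<rho>\<^sup>2" using \<rho> by simp
      also have "\<dots> \<le> K * ?x2" using 3 \<rho> V K KV by (intro mult_mono power_mono) auto
      finally show ?thesis .
    qed
  qed
  with that K V V_bound show thesis by blast
qed

lemma deviation_energy_decay:
  assumes tr: "trajectory F 0 T u y" and K: "0 < K"
    and tail: "\<And>t. t \<in> {0..T} \<Longrightarrow> total_cost t T u y \<le> K * (norm (y t - c))\<^sup>2"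
    and t: "t \<in> {0..T}"
  shows "energy t T (\<lambda>t. y t - c) \<le> total_cost 0 T u y * exp (- (t / K))"
proof -
  define \<phi> where "\<phi> s = (norm (y s - c))\<^sup>2" for s
  have cont: "continuous_on {0..T} \<phi>"
    unfolding \<phi>_def by (intro continuous_intros trajectoryD(2)[OF tr])
  \<comment> \<open>Gronwall in the variable lower limit, with the negative rate
    \<open>- (1 / K)\<close>.\<close>
  have "integral {t..T} \<phi> \<le> integral {0..T} \<phi> * exp (- (1 / K) * (t - 0))"
  proof (rule differential_inequality_bound[where G="\<lambda>s. integral {s..T} \<phi>" and g="\<lambda>s. - \<phi> s" and b=T])
    fix s assume s: "s \<in> {0..T}"
    show "((\<lambda>s. integral {s..T} \<phi>) has_real_derivative - \<phi> s) (at s within {0..T})"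
      by (rule integral_has_real_derivative'[OF cont s])
    have "integral {s..T} \<phi> \<le> total_cost s T u y"
      using energy_nonneg[of s T u] by (simp add: total_cost_def energy_def \<phi>_def[abs_def])
    also have "\<dots> \<le> K * \<phi> s" unfolding \<phi>_def by (rule tail[OF s])
    finally show "- \<phi> s \<le> - (1 / K) * integral {s..T} \<phi>" using K by (simp add: field_simps)
  qed (rule t)
  also have "\<dots> \<le> total_cost 0 T u y * exp (- (t / K))"
    using energy_nonneg[of 0 T u]
    by (simp add: total_cost_def energy_def \<phi>_def[abs_def])
  finally show ?thesis by (simp add: energy_def \<phi>_def[abs_def])
qed

text \<open>The rate \<open>1 / (2 * K)\<close> is half the decay rate of the energy because of the
  square root. The first two terms of the bracket serve \<open>t \<le> 1\<close>, the last one later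
  times; the factor \<open>exp (1 / (2 * K))\<close> pays for looking back one unit of time.\<close>

lemma deviation_decay:
  assumes tr: "trajectory F 0 T u y" and K: "0 < K"
    and tail: "\<And>t. t \<in> {0..T} \<Longrightarrow> total_cost t T u y \<le> K * (norm (y t - c))\<^sup>2"
    and V: "total_cost 0 T u y \<le> V" and t: "t \<in> {0..T}"
  shows "norm (y t - c) \<le> exp (1 / (2 * K)) *
    (norm (y 0 - c) + M * (1 + sqrt V) * sqrt V + (1 + M * (1 + sqrt V) * sqrt K) * sqrt V) * exp (- (1 / (2 * K)) * t)"
    (is "_ \<le> exp ?\<mu> * (?A + ?B) * _")
proof -
  have V0: "0 \<le> V" using V total_cost_nonneg[of 0 T u y] by linarith
  have A: "0 \<le> ?A" and B: "0 \<le> ?B" using V0 K M_pos by simp_all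
  have total_mono: "energy a' b' (\<lambda>t. y t - c) \<le> V" "energy a' b' u \<le> V" if "0 \<le> a'" "b' \<le> T" for a' b'
    using energy_mono[OF trajectory_dist_integrable[OF tr] that, of c] energy_mono[OF trajectoryD(4)[OF tr] that]
      energy_nonneg[of 0 T u] energy_nonneg[of 0 T "\<lambda>t. y t - c"] V
    by (simp_all add: total_cost_def)
  show ?thesis
  proof (cases "t \<le> 1")
    case True
    have tr0: "trajectory F 0 t u y" using trajectory_sub[OF tr] t by simp
    have "norm (y t - c) \<le> norm (y 0 - c) + norm (y t - y 0)"
      using norm_triangle_ineq[of "y 0 - c" "y t - y 0"] by simp
    also have "norm (y t - y 0) \<le> M * (sqrt (t - 0) + sqrt (energy 0 t (\<lambda>t. y t - c))) * sqrt (energy 0 t u)"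
      by (rule increment_bound[OF tr0])
    also have "\<dots> \<le> M * (1 + sqrt V) * sqrt V"
      using True t M_pos V0 total_mono[of 0 t]
      by (intro mult_mono add_mono real_sqrt_le_mono mult_nonneg_nonneg add_nonneg_nonneg)
        (auto simp: energy_nonneg)
    finally have "norm (y t - c) \<le> (?A + ?B) * 1" using B by simp
    also have "\<dots> \<le> (?A + ?B) * exp (?\<mu> + - ?\<mu> * t)"
      using A B True K by (intro mult_left_mono) (auto simp: field_simps)
    finally show ?thesis unfolding exp_add by (simp only: mult_ac)
  next
    case False
    define E where "E = energy (t - 1) T (\<lambda>t. y t - c)"
    have E0: "0 \<le> E" by (simp add: E_def energy_nonneg)
    have EV: "E \<le> V" using total_mono[of "t - 1" T] False by (simp add: E_def)
    have tr1: "trajectory F (t - 1) t u y" using trajectory_sub[OF tr] t False by simp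
    have "continuous_on {t - 1..t} (\<lambda>s. (norm (y s - c))\<^sup>2)"
      by (intro continuous_intros trajectoryD(2)[OF tr1])
    \<comment> \<open>On a window of length one the minimum of the squared deviation is at most its
      integral.\<close>
    then obtain s where s: "s \<in> {t - 1..t}"
      and min: "\<And>r. r \<in> {t - 1..t} \<Longrightarrow> (norm (y s - c))\<^sup>2 \<le> (norm (y r - c))\<^sup>2"
      using continuous_attains_inf[of "{t - 1..t}" "\<lambda>s. (norm (y s - c))\<^sup>2"] by auto
    have "(norm (y s - c))\<^sup>2 = integral {t - 1..t} (\<lambda>_. (norm (y s - c))\<^sup>2)" by simp
    also have "\<dots> \<le> energy (t - 1) t (\<lambda>t. y t - c)"
      unfolding energy_def by (intro integral_le trajectory_dist_integrable[OF tr1] min) auto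
    also have "\<dots> \<le> E"
      unfolding E_def using t False
      by (intro energy_mono trajectory_dist_integrable[OF trajectory_sub[OF tr]]) auto
    finally have xs: "(norm (y s - c))\<^sup>2 \<le> E" .
    have trs: "trajectory F s t u y" and trT: "trajectory F s T u y" and trT1: "trajectory F (t - 1) T u y"
      using trajectory_sub[OF tr] t s False by auto
    have X: "energy s t (\<lambda>t. y t - c) \<le> V" using total_mono[of s t] s t False by simp
    \<comment> \<open>The tail estimate at the good time \<open>s\<close> makes the control energy
      on \<open>[s, t]\<close> small too, so the state cannot move far from
      \<open>y s\<close>.\<close>
    have "energy s t u \<le> energy s T u"
      using t by (intro energy_mono trajectoryD(4)[OF trT]) auto
    also have "\<dots> \<le> total_cost s T u y" by (simp add: total_cost_def energy_nonneg)
    also have "\<dots> \<le> K * (norm (y s - c))\<^sup>2" using s t False by (intro tail) auto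
    also have "\<dots> \<le> K * E" using K xs by (intro mult_left_mono) auto
    finally have U: "energy s t u \<le> K * E" .
    have "norm (y t - c) \<le> norm (y s - c) + norm (y t - y s)"
      using norm_triangle_ineq[of "y s - c" "y t - y s"] by simp
    also have "norm (y s - c) \<le> sqrt E" using xs by (rule real_le_rsqrt)
    also have "norm (y t - y s) \<le> M * (sqrt (t - s) + sqrt (energy s t (\<lambda>t. y t - c))) * sqrt (energy s t u)"
      by (rule increment_bound[OF trs])
    also have "\<dots> \<le> M * (1 + sqrt V) * sqrt (K * E)"
      using s t M_pos V0 U X
      by (intro mult_mono add_mono real_sqrt_le_mono mult_nonneg_nonneg add_nonneg_nonneg)
        (auto simp: energy_nonneg)
    finally have *: "norm (y t - c) \<le> (1 + M * (1 + sqrt V) * sqrt K) * sqrt E"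
      by (simp add: real_sqrt_mult algebra_simps)
    have "E \<le> total_cost 0 T u y * exp (- ((t - 1) / K))"
      unfolding E_def using t False by (intro deviation_energy_decay[OF tr K tail]) auto
    also have "\<dots> \<le> V * exp (- ((t - 1) / K))" using V by (intro mult_right_mono) auto
    \<comment> \<open>Written as a double, so that the exponential becomes a square and the root can
      be taken.\<close>
    also have "- ((t - 1) / K) = 2 * (?\<mu> + - ?\<mu> * t)" using K by (simp add: field_simps)
    also have "exp (2 * (?\<mu> + - ?\<mu> * t)) = (exp (?\<mu> + - ?\<mu> * t))\<^sup>2" by (rule exp_double)
    finally have "sqrt E \<le> sqrt (V * (exp (?\<mu> + - ?\<mu> * t))\<^sup>2)" by (rule real_sqrt_le_mono)
    then have "sqrt E \<le> sqrt V * exp (?\<mu> + - ?\<mu> * t)" by (simp add: real_sqrt_mult)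
    then have "(1 + M * (1 + sqrt V) * sqrt K) * sqrt E \<le> (1 + M * (1 + sqrt V) * sqrt K) * (sqrt V * exp (?\<mu> + - ?\<mu> * t))"
      using M_pos V0 K by (intro mult_left_mono) auto
    also have "\<dots> = ?B * exp (?\<mu> + - ?\<mu> * t)" by (simp only: mult.assoc)
    also have "\<dots> \<le> (?A + ?B) * exp (?\<mu> + - ?\<mu> * t)" using A by (intro mult_right_mono) auto
    finally have "norm (y t - c) \<le> (?A + ?B) * exp (?\<mu> + - ?\<mu> * t)" using * by (rule order_trans[rotated])
    then show ?thesis unfolding exp_add by (simp only: mult_ac)
  qed
qed

theorem optimal_exponential_decay:
  assumes ctrl: "controllable_with_local_cost F T0 c" and T0: "0 < T0"
  shows "\<exists>C>0. \<exists>\<mu>>0. \<forall>T\<ge>T0. \<forall>u y. optimal T u y \<longrightarrow> y 0 = y0 \<longrightarrow>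
    (\<forall>t\<in>{0..T}. norm (y t - c) \<le> C * exp (- \<mu> * t)) \<and>
    (AE t in lebesgue_on {0..T}. norm (u t) \<le> C * exp (- \<mu> * t))"
proof -
  obtain K V where K: "0 < K" and V: "0 < V"
    and V_bound: "\<And>T u y. optimal T u y \<Longrightarrow> y 0 = y0 \<Longrightarrow> T0 \<le> T \<Longrightarrow> total_cost 0 T u y \<le> V"
    and tail: "\<And>T u y t. optimal T u y \<Longrightarrow> y 0 = y0 \<Longrightarrow> T0 \<le> T \<Longrightarrow> t \<in> {0..T} \<Longrightarrow>
      total_cost t T u y \<le> K * (norm (y t - c))\<^sup>2"
    using optimal_tail_le_deviation[OF ctrl T0] by metis
  define \<mu> where "\<mu> = 1 / (2 * K)"
  define C where "C = exp \<mu> *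
    (norm (y0 - c) + M * (1 + sqrt V) * sqrt V + (1 + M * (1 + sqrt V) * sqrt K) * sqrt V)"
  have \<mu>: "0 < \<mu>" using K by (simp add: \<mu>_def)
  have C: "0 < C" unfolding C_def using K V M_pos
    by (intro mult_pos_pos add_nonneg_pos add_pos_nonneg) auto
  \<comment> \<open>The constant is doubled for the control, whose bound carries a factor
    \<open>sqrt 2 \<le> 2\<close>.\<close>
  have "(\<forall>t\<in>{0..T}. norm (y t - c) \<le> (2 * C) * exp (- \<mu> * t)) \<and>
      (AE t in lebesgue_on {0..T}. norm (u t) \<le> (2 * C) * exp (- \<mu> * t))"
    if T: "T0 \<le> T" and opt: "optimal T u y" and y0: "y 0 = y0" for T u y
  proof
    from opt have tr: "trajectory F 0 T u y" by (simp add: optimal_def)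
    have dev: "norm (y t - c) \<le> C * exp (- \<mu> * t)" if "t \<in> {0..T}" for t
      using deviation_decay[OF tr K tail[OF opt y0 T] V_bound[OF opt y0 T] that] y0
      by (simp add: C_def \<mu>_def)
    have "C * exp (- \<mu> * t) \<le> 2 * C * exp (- \<mu> * t)" for t using C by simp
    with dev show "\<forall>t\<in>{0..T}. norm (y t - c) \<le> (2 * C) * exp (- \<mu> * t)"
      by (meson order_trans)
    have "AE t in lebesgue_on {0..T}. t \<in> {0..T}" by (rule AE_I2) simp
    with optimal_control_le[OF opt]
    show "AE t in lebesgue_on {0..T}. norm (u t) \<le> (2 * C) * exp (- \<mu> * t)"
    proof eventually_elim
      fix t assume u: "(norm (u t))\<^sup>2 \<le> 2 * (norm (y t - c))\<^sup>2" and t: "t \<in> {0..T}"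
      note u
      also have "2 * (norm (y t - c))\<^sup>2 \<le> (2 * norm (y t - c))\<^sup>2" by (simp add: power_mult_distrib)
      finally have "norm (u t) \<le> 2 * norm (y t - c)" by (rule power2_le_imp_le) simp
      also have "\<dots> \<le> (2 * C) * exp (- \<mu> * t)" using dev[OF t] by simp
      finally show "norm (u t) \<le> (2 * C) * exp (- \<mu> * t)" .
    qed
  qed
  then show ?thesis using C \<mu> by (intro exI[of _ "2 * C"] exI[of _ \<mu>]) auto
qed

end

section \<open>Globally Lipschitz vector fields and the final result\<close>

lemma driftless_system_driftless:
  fixes fs :: "'m::finite \<Rightarrow> real^'d::finite \<Rightarrow> real^'d"
  assumes lip: "\<And>j. \<exists>L. L-lipschitz_on UNIV (fs j)"
  shows "\<exists>M. driftless_system (driftless fs) c M"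
proof -
  obtain L where L: "\<And>j. (L j)-lipschitz_on UNIV (fs j)" using lip by metis
  have L0: "0 \<le> L j" for j using lipschitz_on_nonneg[OF L] .
  have Lip: "norm (fs j y - fs j z) \<le> L j * norm (y - z)" for j y z
    using lipschitz_onD[OF L[of j], of y z] by (simp add: dist_norm)
  \<comment> \<open>\<open>B j\<close> dominates both the Lipschitz constant of \<open>fs j\<close>
    and its linear growth around \<open>c\<close>, so \<open>sum_bound\<close> yields both
    estimates.\<close>
  define B where "B j = L j + norm (fs j c)" for j
  define M where "M = 1 + sum B UNIV"
  have B0: "0 \<le> B j" for j using L0 by (simp add: B_def)
  have sum_bound: "norm (\<Sum>j\<in>UNIV. (u $ j) *\<^sub>R g j) \<le> M * (a * norm u)"
    if g: "\<And>j. norm (g j) \<le> B j * a" and a: "0 \<le> a" for u :: "real^'m" and g :: "'m \<Rightarrow> real^'d" and a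
  proof -
    have "norm (\<Sum>j\<in>UNIV. (u $ j) *\<^sub>R g j) \<le> (\<Sum>j\<in>UNIV. norm u * (B j * a))"
      using g component_le_norm_cart[of u] by (intro sum_norm_le) (auto intro!: mult_mono)
    also have "\<dots> = sum B UNIV * (a * norm u)" by (simp add: sum_distrib_left sum_distrib_right mult_ac)
    also have "\<dots> \<le> M * (a * norm u)" using a by (intro mult_right_mono) (auto simp: M_def)
    finally show ?thesis .
  qed
  have "driftless_system (driftless fs) c M"
  proof
    show "0 < M" unfolding M_def using sum_nonneg[of UNIV B] B0 by (simp add: add_pos_nonneg)
    fix y z :: "real^'d" and u :: "real^'m" and k :: real
    show "driftless fs y (k *\<^sub>R u) = k *\<^sub>R driftless fs y u"
      by (simp add: driftless_def scaleR_sum_right)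
    have "norm (fs j y - fs j z) \<le> B j * norm (y - z)" for j
      using Lip[of j y z] mult_right_mono[of "L j" "B j" "norm (y - z)"] by (simp add: B_def)
    from sum_bound[OF this]
    show "norm (driftless fs y u - driftless fs z u) \<le> M * (norm (y - z) * norm u)"
      by (simp add: driftless_def scaleR_diff_right flip: sum_subtractf)
    have "norm (fs j y) \<le> B j * (1 + norm (y - c))" for j
    proof -
      have "norm (fs j y) \<le> norm (fs j c) + L j * norm (y - c)"
        using norm_triangle_ineq[of "fs j c" "fs j y - fs j c"] Lip[of j y c] by simp
      also have "\<dots> \<le> B j * (1 + norm (y - c))" using L0[of j] by (simp add: B_def algebra_simps)
      finally show ?thesis .
    qed
    from sum_bound[OF this]
    show "norm (driftless fs y u) \<le> M * ((1 + norm (y - c)) * norm u)"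
      by (simp add: driftless_def)
  qed
  then show ?thesis ..
qed

theorem corollary2p2:
  fixes fs :: "'m::finite \<Rightarrow> real^'d::finite \<Rightarrow> real^'d"
    and ybar y0 :: "real^'d" and T0 :: real
  assumes "\<And>j. \<exists>L. L-lipschitz_on UNIV (fs j)"
    and "T0 > 0"
    and "controllable_with_local_cost (driftless fs) T0 ybar"
  shows "\<exists>Tstar>0. \<exists>C>0. \<exists>\<mu>>0. \<forall>T>Tstar. \<forall>uT yT.
    global_minimizer (driftless fs) y0 ybar T uT \<longrightarrow>
    is_solution (driftless fs) T y0 uT yT \<longrightarrow>
      (\<forall>t\<in>{0..T}. norm (yT t - ybar) \<le> C * exp (- \<mu> * t)) \<and>
      (AE t in lebesgue_on {0..T}. norm (uT t) \<le> C * exp (- \<mu> * t))"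
proof -
  obtain M where "driftless_system (driftless fs) ybar M"
    using driftless_system_driftless[where fs=fs, OF assms(1)] by blast
  then interpret driftless_system "driftless fs" ybar M .
  obtain C \<mu> where pos: "C > 0" "\<mu> > 0"
    and decay: "\<And>T u y. T0 \<le> T \<Longrightarrow> optimal T u y \<Longrightarrow> y 0 = y0 \<Longrightarrow>
      (\<forall>t\<in>{0..T}. norm (y t - ybar) \<le> C * exp (- \<mu> * t)) \<and>
      (AE t in lebesgue_on {0..T}. norm (u t) \<le> C * exp (- \<mu> * t))"
    using optimal_exponential_decay[OF assms(3,2), of y0] by blast
  have "(\<forall>t\<in>{0..T}. norm (y t - ybar) \<le> C * exp (- \<mu> * t)) \<and>
      (AE t in lebesgue_on {0..T}. norm (u t) \<le> C * exp (- \<mu> * t))"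
    if T: "T > T0" and u: "global_minimizer (driftless fs) y0 ybar T u"
      and y: "is_solution (driftless fs) T y0 u y" for T u y
  proof (rule decay)
    have "0 \<le> T" using T assms(2) by simp
    from minimizer_optimal[OF u y this] show "optimal T u y" "y 0 = y0" .
  qed (use T in simp)
  \<comment> \<open>\<open>T0\<close> itself serves as \<open>Tstar\<close>.\<close>
  with pos assms(2) show ?thesis by blast
qed

end
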